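(* Let $A$ be a finite-dimensional evolution algebra over a field $\mathbb{K}$ and $S$ a subset of $A$. (1) Suppose $S$ is a cut of over unicity for $A$. Then for every pair of different evolution ideals $I,J$ of $A$ containing $S$ such that there exists an evolution ideal $R$ with $S\subseteq R\in\operatorname{MaxEvid}(I\cap J)$, there exists exactly one evolution ideal $T$ of $A$ with $T\in\operatorname{MinEvid}(I\cup J)$. Moreover, under this circumstance, the evolution ideal $R$ is unique: if there exists an evolution ideal $R$ with $S\subseteq R\in\operatorname{MaxEvid}(I\cap J)$, then it is the only one. (2) Suppose $S$ is a cut of below unicity for $A$. Then for every pair of different evolution ideals $I,J$ of $A$ contained in $S$ such that there exists an evolution ideal $R$ with $S\supseteq R\in\operatorname{MinEvid}(I\cup J)$, there exists exactly one evolution ideal $T$ of $A$ with $T\in\operatorname{MaxEvid}(I\cap J)$. Moreover, under this circumstance, the evolution ideal $R$ is unique: if there exists an evolution ideal $R$ with $S\supseteq R\in\operatorname{MinEvid}(I\cup J)$, then it is the only one.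
   Context: An algebra over a field $\mathbb{K}$ is a $\mathbb{K}$-vector space with a bilinear multiplication (not necessarily associative). "Ideal" means two-sided ideal. A natural basis of an algebra is a vector space basis $\{e_i\}$ with $e_ie_j=0$ for $i\neq j$; an evolution algebra is an algebra having a natural basis. An evolution ideal of $A$ is an ideal of $A$ which, as an algebra, has a natural basis; $\{0\}$ is an evolution ideal (with empty natural basis). For $T\subseteq A$, $\operatorname{MinEvid}(T)$ is the set of evolution ideals of $A$ that are minimal (for inclusion) among the evolution ideals of $A$ containing $T$, and $\operatorname{MaxEvid}(T)$ is the set of evolution ideals of $A$ that are maximal among the evolution ideals of $A$ contained in $T$. $\operatorname{Evido}(S)$ is the set of all evolution ideals of $A$ containing $S$; $\operatorname{Evidb}(S)$ is the set of all evolution ideals of $A$ contained in $S$. A lattice definable over $S$ is a triple $(H,f',g')$ where $H\subseteq\operatorname{Evido}(S)$ is ordered by inclusion and $f',g'$ are maps from the set of two-element subsets of $H$ to $H$ such that for all distinct $X,Y\in H$: $f'(\{X,Y\})\in\operatorname{MaxEvid}(X\cap Y)$, $g'(\{X,Y\})\in\operatorname{MinEvid}(X\cup Y)$, and $f'(\{X,Y\})$, $g'(\{X,Y\})$ are respectively the infimum and the supremum of $\{X,Y\}$ in $(H,\subseteq)$ (the empty set is accepted as a lattice). A lattice definable below $S$ is defined in the same way with $\operatorname{Evidb}(S)$ in place of $\operatorname{Evido}(S)$. For lattices $L,M$ of this kind, $L\leq_{\mathrm{latt}}M$ means that $L\subseteq M$ as sets and, for every two distinct elements $a,b\in L$, $\inf_L(\{a,b\})=\inf_M(\{a,b\})$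 and $\sup_L(\{a,b\})=\sup_M(\{a,b\})$. $S$ is a cut of over (respectively below) unicity for $A$ if there exists exactly one lattice definable over (respectively below) $S$ that is maximal for $\leq_{\mathrm{latt}}$. *)

theory Defs
  imports Complex_Main "HOL-Library.FuncSet"
begin

text \<open>The algebra is the whole type \<open>'a\<close>; multiplication need not be associative,
  commutative or unital.\<close>

locale nonassoc_algebra = vector_space scale
  for scale :: "'k::field \<Rightarrow> 'a::ab_group_add \<Rightarrow> 'a" +
  fixes mult :: "'a \<Rightarrow> 'a \<Rightarrow> 'a"
  assumes linear_mult_left: "\<And>x. Vector_Spaces.linear scale scale (\<lambda>y. mult x y)"
    and linear_mult_right: "\<And>y. Vector_Spaces.linear scale scale (\<lambda>x. mult x y)"

text \<open>A triple \<open>(H, f, g)\<close>: underlying set, infimum map, supremum map.\<close>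

type_synonym 'a latt = "'a set set \<times> ('a set set \<Rightarrow> 'a set) \<times> ('a set set \<Rightarrow> 'a set)"

definition two_subsets :: "'b set \<Rightarrow> 'b set set" where
  "two_subsets H = {P. P \<subseteq> H \<and> card P = 2}"

definition is_inf_in :: "'a set set \<Rightarrow> 'a set set \<Rightarrow> 'a set \<Rightarrow> bool" where
  "is_inf_in H P Z \<longleftrightarrow> Z \<in> H \<and> (\<forall>X\<in>P. Z \<subseteq> X) \<and> (\<forall>W\<in>H. (\<forall>X\<in>P. W \<subseteq> X) \<longrightarrow> W \<subseteq> Z)"

definition is_sup_in :: "'a set set \<Rightarrow> 'a set set \<Rightarrow> 'a set \<Rightarrow> bool" where
  "is_sup_in H P Z \<longleftrightarrow> Z \<in> H \<and> (\<forall>X\<in>P. X \<subseteq> Z) \<and> (\<forall>W\<in>H. (\<forall>X\<in>P. X \<subseteq> W) \<longrightarrow> Z \<subseteq> W)"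

fun le_latt :: "'a latt \<Rightarrow> 'a latt \<Rightarrow> bool" where
  "le_latt (H, f, g) (H', f', g') \<longleftrightarrow>
    H \<subseteq> H' \<and> (\<forall>X\<in>H. \<forall>Y\<in>H. X \<noteq> Y \<longrightarrow> f {X, Y} = f' {X, Y} \<and> g {X, Y} = g' {X, Y})"

definition maximal_latt :: "('a latt \<Rightarrow> bool) \<Rightarrow> 'a latt \<Rightarrow> bool" where
  "maximal_latt P L \<longleftrightarrow> P L \<and> (\<forall>M. P M \<and> le_latt L M \<longrightarrow> M = L)"

context nonassoc_algebra
begin

definition natural_basis :: "'a set \<Rightarrow> 'a set \<Rightarrow> bool" where
  "natural_basis V B \<longleftrightarrow> B \<subseteq> V \<and> independent B \<and> span B = V \<and>
    (\<forall>x\<in>B. \<forall>y\<in>B. x \<noteq> y \<longrightarrow> mult x y = 0)"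

definition evolution_algebra :: bool where
  "evolution_algebra \<longleftrightarrow> (\<exists>B. natural_basis UNIV B)"

definition is_ideal :: "'a set \<Rightarrow> bool" where
  "is_ideal I \<longleftrightarrow> subspace I \<and> (\<forall>a. \<forall>x\<in>I. mult a x \<in> I \<and> mult x a \<in> I)"

definition evolution_ideal :: "'a set \<Rightarrow> bool" where
  "evolution_ideal I \<longleftrightarrow> is_ideal I \<and> (\<exists>B. natural_basis I B)"

definition Evido :: "'a set \<Rightarrow> 'a set set" where
  "Evido S = {I. evolution_ideal I \<and> S \<subseteq> I}"

definition Evidb :: "'a set \<Rightarrow> 'a set set" where
  "Evidb S = {I. evolution_ideal I \<and> I \<subseteq> S}"

definition MinEvid :: "'a set \<Rightarrow> 'a set set" where
  "MinEvid T = {I \<in> Evido T. \<forall>J\<in>Evido T. J \<subseteq> I \<longrightarrow> J = I}"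

definition MaxEvid :: "'a set \<Rightarrow> 'a set set" where
  "MaxEvid T = {I \<in> Evidb T. \<forall>J\<in>Evidb T. I \<subseteq> J \<longrightarrow> J = I}"

text \<open>The maps are extensional (\<open>\<rightarrow>\<^sub>E\<close>), so that equality of triples only
  depends on their values on two-element subsets of \<open>H\<close>.\<close>

fun lattice_in :: "'a set set \<Rightarrow> 'a latt \<Rightarrow> bool" where
  "lattice_in E (H, f, g) \<longleftrightarrow>
    H \<subseteq> E \<and> f \<in> two_subsets H \<rightarrow>\<^sub>E H \<and> g \<in> two_subsets H \<rightarrow>\<^sub>E H \<and>
    (\<forall>X\<in>H. \<forall>Y\<in>H. X \<noteq> Y \<longrightarrow>
      f {X, Y} \<in> MaxEvid (X \<inter> Y) \<and> g {X, Y} \<in> MinEvid (X \<union> Y) \<and>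
      is_inf_in H {X, Y} (f {X, Y}) \<and> is_sup_in H {X, Y} (g {X, Y}))"

definition lattice_over :: "'a set \<Rightarrow> 'a latt \<Rightarrow> bool" where
  "lattice_over S = lattice_in (Evido S)"

definition lattice_below :: "'a set \<Rightarrow> 'a latt \<Rightarrow> bool" where
  "lattice_below S = lattice_in (Evidb S)"

definition cut_of_over_unicity :: "'a set \<Rightarrow> bool" where
  "cut_of_over_unicity S \<longleftrightarrow> (\<exists>!L. maximal_latt (lattice_over S) L)"

definition cut_of_below_unicity :: "'a set \<Rightarrow> bool" where
  "cut_of_below_unicity S \<longleftrightarrow> (\<exists>!L. maximal_latt (lattice_below S) L)"

end

end

theory Submission imports Defs begin

text \<open>Lattices are closed under unions of chains for \<open>le_latt\<close>, so by Zorn's lemma each of them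
  lies below a maximal one. If there is only one maximal lattice, then any two lattices agree on
  their common two-element subsets. For \<open>R \<in> MaxEvid (I \<inter> J)\<close> and \<open>T \<in> MinEvid (I \<union> J)\<close> the set
  \<open>{R, I, J, T}\<close> carries a lattice structure with infimum \<open>R\<close> and supremum \<open>T\<close> of \<open>{I, J}\<close>; hence
  \<open>R\<close> and \<open>T\<close> are determined by \<open>I\<close> and \<open>J\<close>. Minimal and maximal evolution ideals exist
  because the dimension is finite.\<close>

section \<open>Two-element sets and the order on lattices\<close>

text \<open>Every two-element set is some \<open>{X, Y}\<close> with \<open>X \<noteq> Y\<close>.
  This lets the conditions on lattices and on \<open>le_latt\<close> be stated for the arguments
  \<open>P\<close> that the infimum and supremum maps actually take.\<close>

lemma ball_two_subsets:
  "(\<forall>P\<in>two_subsets H. Q P) \<longleftrightarrow> (\<forall>X\<in>H. \<forall>Y\<in>H. X \<noteq> Y \<longrightarrow> Q {X, Y})"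
proof
  assume "\<forall>P\<in>two_subsets H. Q P"
  then show "\<forall>X\<in>H. \<forall>Y\<in>H. X \<noteq> Y \<longrightarrow> Q {X, Y}"
    by (simp add: two_subsets_def)
next
  assume "\<forall>X\<in>H. \<forall>Y\<in>H. X \<noteq> Y \<longrightarrow> Q {X, Y}"
  then show "\<forall>P\<in>two_subsets H. Q P"
    by (auto simp: two_subsets_def card_2_iff)
qed

lemma two_subsets_mono: "H \<subseteq> H' \<Longrightarrow> two_subsets H \<subseteq> two_subsets H'"
  by (auto simp: two_subsets_def)

lemma le_latt_iff:
  "le_latt (H, f, g) (H', f', g') \<longleftrightarrow>
    H \<subseteq> H' \<and> (\<forall>P\<in>two_subsets H. f P = f' P \<and> g P = g' P)"
  by (simp add: ball_two_subsets)

declare le_latt.simps [simp del]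

lemma le_latt_refl: "le_latt L L"
  by (cases L) (simp add: le_latt_iff)

lemma le_latt_trans:
  assumes "le_latt L M" "le_latt M N"
  shows "le_latt L N"
proof -
  obtain H f g H' f' g' H'' f'' g''
    where "L = (H, f, g)" "M = (H', f', g')" "N = (H'', f'', g'')"
    by (metis prod_cases3)
  then show ?thesis
    using assms two_subsets_mono[of H H'] by (auto simp: le_latt_iff)
qed

context nonassoc_algebra
begin

lemma lattice_in_iff:
  "lattice_in E (H, f, g) \<longleftrightarrow>
    H \<subseteq> E \<and> f \<in> two_subsets H \<rightarrow>\<^sub>E H \<and> g \<in> two_subsets H \<rightarrow>\<^sub>E H \<and>
    (\<forall>P\<in>two_subsets H. f P \<in> MaxEvid (\<Inter>P) \<and> g P \<in> MinEvid (\<Union>P) \<and>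
      is_inf_in H P (f P) \<and> is_sup_in H P (g P))"
  by (simp add: ball_two_subsets)

declare lattice_in.simps [simp del]

section \<open>Maximal lattices by Zorn's lemma\<close>

text \<open>The order compares the maps on two-element subsets only; antisymmetry comes from
  extensionality, which fixes their values everywhere else.\<close>

lemma le_latt_antisym:
  assumes "lattice_in E L" "lattice_in E M" "le_latt L M" "le_latt M L"
  shows "L = M"
proof -
  obtain H f g H' f' g' where LM: "L = (H, f, g)" "M = (H', f', g')"
    by (metis prod_cases3)
  have H: "H = H'"
    using assms LM by (auto simp: le_latt_iff)
  have eq: "f P = f' P" "g P = g' P" if "P \<in> two_subsets H" for P
    using assms(3) LM that by (auto simp: le_latt_iff)
  have "f \<in> two_subsets H \<rightarrow>\<^sub>E H" "f' \<in> two_subsets H \<rightarrow>\<^sub>E H"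
    "g \<in> two_subsets H \<rightarrow>\<^sub>E H" "g' \<in> two_subsets H \<rightarrow>\<^sub>E H"
    using assms(1,2) LM H by (auto simp: lattice_in_iff)
  with eq have "f = f'" "g = g'"
    by (metis PiE_ext)+
  with LM H show ?thesis by simp
qed

text \<open>The union of the carriers works because each lattice condition involves a pair
  \<open>P\<close> and at most one competitor \<open>W\<close>, and three elements of the union
  already lie in a single member of the chain.\<close>

lemma lattice_in_chain_upper_bound:
  assumes lat: "\<And>L. L \<in> C \<Longrightarrow> lattice_in E L"
    and chain: "\<And>L M. L \<in> C \<Longrightarrow> M \<in> C \<Longrightarrow> le_latt L M \<or> le_latt M L"
  obtains U where "lattice_in E U" "\<And>L. L \<in> C \<Longrightarrow> le_latt L U"
proof -
  define H where "H = (\<Union>L\<in>C. fst L)"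
  \<comment> \<open>Any member of the chain containing \<open>P\<close> may supply the values at
    \<open>P\<close>: comparable lattices agree on common pairs, so the choice does not matter, as
    \<open>agree\<close> records.\<close>
  define pick where "pick P = (SOME L. L \<in> C \<and> P \<in> two_subsets (fst L))" for P
  define f where "f = restrict (\<lambda>P. fst (snd (pick P)) P) (two_subsets H)"
  define g where "g = restrict (\<lambda>P. snd (snd (pick P)) P) (two_subsets H)"
  have subH: "two_subsets HL \<subseteq> two_subsets H" if "(HL, fL, gL) \<in> C" for HL fL gL
    using that by (intro two_subsets_mono) (force simp: H_def)
  have agree: "f P = fL P \<and> g P = gL P"
    if L: "(HL, fL, gL) \<in> C" and P: "P \<in> two_subsets HL" for HL fL gL P
  proof -
    obtain H' f' g' where pick: "pick P = (H', f', g')"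
      by (metis prod_cases3)
    have "pick P \<in> C \<and> P \<in> two_subsets (fst (pick P))"
      unfolding pick_def by (rule someI[of _ "(HL, fL, gL)"]) (use L P in simp)
    then have "(H', f', g') \<in> C" "P \<in> two_subsets H'"
      by (simp_all add: pick)
    with chain[OF L, of "(H', f', g')"] P have "f' P = fL P \<and> g' P = gL P"
      by (auto simp: le_latt_iff)
    then show ?thesis
      using subH[OF L] P by (auto simp: f_def g_def pick)
  qed
  have cover: "\<exists>HL fL gL. (HL, fL, gL) \<in> C \<and> P \<in> two_subsets HL \<and> W \<in> HL"
    if P: "P \<in> two_subsets H" and W: "W \<in> H" for P W
  proof -
    have nested: "fst L \<subseteq> fst M \<or> fst M \<subseteq> fst L" if "L \<in> C" "M \<in> C" for L M
      using chain[OF that] by (cases L; cases M) (auto simp: le_latt_iff)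
    obtain X Y where XY: "P = {X, Y}" "X \<noteq> Y" "X \<in> H" "Y \<in> H"
      using P by (auto simp: two_subsets_def card_2_iff)
    obtain L M N where LMN: "L \<in> C" "X \<in> fst L" "M \<in> C" "Y \<in> fst M" "N \<in> C" "W \<in> fst N"
      using XY(3,4) W unfolding H_def by blast
    obtain K where "K \<in> C" "{X, Y, W} \<subseteq> fst K"
      using LMN nested[of L M] nested[of M N] nested[of L N] by blast
    with XY show ?thesis
      by (cases K) (auto simp: two_subsets_def)
  qed
  have vals: "f P \<in> H \<and> g P \<in> H \<and> f P \<in> MaxEvid (\<Inter>P) \<and> g P \<in> MinEvid (\<Union>P) \<and>
      is_inf_in H P (f P) \<and> is_sup_in H P (g P)" if P: "P \<in> two_subsets H" for P
  proof -
    \<comment> \<open>The bounds are tested against one \<open>W\<close> at a time, inside a member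
      of the chain that contains both \<open>P\<close> and \<open>W\<close>; that member may change
      with \<open>W\<close>.\<close>
    have local: "f P \<in> H \<and> g P \<in> H \<and> f P \<in> MaxEvid (\<Inter>P) \<and> g P \<in> MinEvid (\<Union>P) \<and>
        (\<forall>X\<in>P. f P \<subseteq> X \<and> X \<subseteq> g P) \<and>
        ((\<forall>X\<in>P. W \<subseteq> X) \<longrightarrow> W \<subseteq> f P) \<and> ((\<forall>X\<in>P. X \<subseteq> W) \<longrightarrow> g P \<subseteq> W)"
      if W: "W \<in> H" for W
    proof -
      obtain HL fL gL where L: "(HL, fL, gL) \<in> C" "P \<in> two_subsets HL" "W \<in> HL"
        using cover[OF P W] by blast
      have "HL \<subseteq> H" using L(1) by (force simp: H_def)
      moreover have "is_inf_in HL P (fL P)" "is_sup_in HL P (gL P)"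
        "fL P \<in> MaxEvid (\<Inter>P)" "gL P \<in> MinEvid (\<Union>P)"
        using lat[OF L(1)] L(2) by (auto simp: lattice_in_iff)
      ultimately show ?thesis
        using agree[OF L(1,2)] L(3) by (auto simp: is_inf_in_def is_sup_in_def)
    qed
    \<comment> \<open>Some \<open>W\<close> is required to extract from \<open>local\<close> the
      conjuncts that do not mention \<open>W\<close>.\<close>
    have "H \<noteq> {}" using P by (auto simp: two_subsets_def)
    with local show ?thesis
      unfolding is_inf_in_def is_sup_in_def by blast
  qed
  show thesis
  proof
    have "H \<subseteq> E"
    proof
      fix X assume "X \<in> H"
      then obtain L where "L \<in> C" "X \<in> fst L" by (auto simp: H_def)
      with lat[of L] show "X \<in> E" by (cases L) (auto simp: lattice_in_iff)
    qed
    moreover have "f \<in> two_subsets H \<rightarrow>\<^sub>E H" "g \<in> two_subsets H \<rightarrow>\<^sub>E H"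
      using vals by (auto simp: f_def g_def)
    ultimately show "lattice_in E (H, f, g)"
      using vals by (simp add: lattice_in_iff)
    show "le_latt L (H, f, g)" if "L \<in> C" for L
      using that agree by (cases L) (force simp: le_latt_iff H_def)
  qed
qed

lemma lattice_in_extends_to_maximal:
  assumes L0: "lattice_in E L0"
  obtains L where "maximal_latt (lattice_in E) L" "le_latt L0 L"
proof -
  let ?A = "{L. lattice_in E L \<and> le_latt L0 L}"
  have "\<exists>m\<in>?A. \<forall>a\<in>?A. le_latt m a \<longrightarrow> a = m"
  proof (rule predicate_Zorn)
    show "partial_order_on ?A (relation_of le_latt ?A)"
      by (rule partial_order_on_relation_ofI)
        (blast intro: le_latt_refl le_latt_trans le_latt_antisym)+
    fix C assume C: "C \<in> Chains (relation_of le_latt ?A)"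
    have CA: "C \<subseteq> ?A"
      using C by (auto simp: Chains_def relation_of_def)
    show "\<exists>u\<in>?A. \<forall>a\<in>C. le_latt a u"
    \<comment> \<open>An upper bound of the empty chain need not lie above \<open>L0\<close>, so
      \<open>L0\<close> itself is taken there. Otherwise any member of \<open>C\<close> links
      \<open>L0\<close> to \<open>U\<close>.\<close>
    proof (cases "C = {}")
      case True
      with L0 le_latt_refl show ?thesis by blast
    next
      case False
      have "le_latt L M \<or> le_latt M L" if "L \<in> C" "M \<in> C" for L M
        using C that by (auto simp: Chains_def relation_of_def)
      moreover have "lattice_in E L" if "L \<in> C" for L
        using CA that by blast
      ultimately obtain U where "lattice_in E U" "\<And>L. L \<in> C \<Longrightarrow> le_latt L U"
        using lattice_in_chain_upper_bound by blast
      with False CA show ?thesis by (blast intro: le_latt_trans)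
    qed
  qed
  then obtain L where L: "lattice_in E L" "le_latt L0 L"
    and max: "\<And>M. lattice_in E M \<Longrightarrow> le_latt L0 M \<Longrightarrow> le_latt L M \<Longrightarrow> M = L"
    by blast
  \<comment> \<open>A lattice above \<open>L\<close> is also above \<open>L0\<close>, so maximality
    within \<open>?A\<close> is maximality among all lattices in \<open>E\<close>.\<close>
  show thesis
    using L max le_latt_trans[OF L(2)] that[of L] by (auto simp: maximal_latt_def)
qed

section \<open>Agreement of lattices and four-element diamonds\<close>

text \<open>Both lattices extend to maximal ones, which coincide by uniqueness; the maps of this
  common extension restrict to those of each lattice.\<close>

lemma lattice_in_agree:
  assumes unique: "\<exists>!L. maximal_latt (lattice_in E) L"
    and "lattice_in E (H, f, g)" "lattice_in E (H', f', g')"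
    and "P \<in> two_subsets H" "P \<in> two_subsets H'"
  shows "f P = f' P" "g P = g' P"
proof -
  obtain L M where "maximal_latt (lattice_in E) L" "le_latt (H, f, g) L"
    "maximal_latt (lattice_in E) M" "le_latt (H', f', g') M"
    using assms(2,3) lattice_in_extends_to_maximal by metis
  moreover from this have "M = L" using unique by blast
  moreover obtain HL fL gL where "L = (HL, fL, gL)" by (metis prod_cases3)
  ultimately show "f P = f' P" "g P = g' P"
    using assms(4,5) by (auto simp: le_latt_iff)
qed

text \<open>\<open>I\<close> and \<open>J\<close> may be comparable; then \<open>R\<close> and \<open>T\<close> coincide with them.\<close>

lemma diamond_lattice:
  assumes E: "E \<subseteq> Collect evolution_ideal" and mem: "R \<in> E" "I \<in> E" "J \<in> E" "T \<in> E"
    and "I \<noteq> J" and R: "R \<in> MaxEvid (I \<inter> J)" and T: "T \<in> MinEvid (I \<union> J)"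
  obtains f g where "lattice_in E ({R, I, J, T}, f, g)" "f {I, J} = R" "g {I, J} = T"
proof -
  define H where "H = {R, I, J, T}"
  \<comment> \<open>Since \<open>R\<close> is below and \<open>T\<close> above every element of
    \<open>H\<close>, all pairs other than \<open>{I, J}\<close> are comparable. For these,
    intersection and union simply return the smaller and the larger element.\<close>
  define f where "f = restrict (\<lambda>P. if P = {I, J} then R else \<Inter>P) (two_subsets H)"
  define g where "g = restrict (\<lambda>P. if P = {I, J} then T else \<Union>P) (two_subsets H)"
  have IJ: "{I, J} \<in> two_subsets H"
    using \<open>I \<noteq> J\<close> by (simp add: two_subsets_def H_def)
  have le: "R \<subseteq> I" "R \<subseteq> J" "I \<subseteq> T" "J \<subseteq> T"
    using R T by (auto simp: MaxEvid_def MinEvid_def Evidb_def Evido_def)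
  have bounds: "R \<subseteq> W \<and> W \<subseteq> T" if "W \<in> H" for W
    using that le by (auto simp: H_def)
  have evol: "evolution_ideal W" if "W \<in> H" for W
    using that E mem by (auto simp: H_def)
  \<comment> \<open>A maximal evolution ideal in \<open>I \<inter> J\<close> need not be the
    greatest one. Within \<open>H\<close>, however, \<open>bounds\<close> gives
    \<open>R \<subseteq> W\<close>, so maximality forces \<open>W = R\<close>; dually for
    \<open>T\<close>.\<close>
  have infR: "W \<subseteq> R" if "W \<in> H" "W \<subseteq> I" "W \<subseteq> J" for W
    using that R evol[of W] bounds[of W] by (auto simp: MaxEvid_def Evidb_def)
  have supT: "T \<subseteq> W" if "W \<in> H" "I \<subseteq> W" "J \<subseteq> W" for W
    using that T evol[of W] bounds[of W] by (auto simp: MinEvid_def Evido_def)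
  have vals: "f P \<in> H \<and> g P \<in> H \<and> f P \<in> MaxEvid (\<Inter>P) \<and> g P \<in> MinEvid (\<Union>P) \<and>
      is_inf_in H P (f P) \<and> is_sup_in H P (g P)" if P: "P \<in> two_subsets H" for P
  proof (cases "P = {I, J}")
    case True
    have "f P = R" "g P = T" using P True by (simp_all add: f_def g_def)
    moreover have "R \<in> H" "T \<in> H" by (simp_all add: H_def)
    moreover have "is_inf_in H P R" "is_sup_in H P T"
      using True le infR supT \<open>R \<in> H\<close> \<open>T \<in> H\<close> by (auto simp: is_inf_in_def is_sup_in_def)
    ultimately show ?thesis using True R T by simp
  next
    case False
    obtain X Y where XY: "P = {X, Y}" "X \<in> H" "Y \<in> H" "X \<subseteq> Y"
    proof -
      obtain X Y where "P = {X, Y}" "X \<in> H" "Y \<in> H"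
        using P by (auto simp: two_subsets_def card_2_iff)
      moreover from this have "X \<subseteq> Y \<or> Y \<subseteq> X"
        using False le by (auto simp: H_def)
      ultimately show thesis using that by (metis insert_commute)
    qed
    have meet: "\<Inter>P = X" and join: "\<Union>P = Y" using XY by auto
    have "f P = X" "g P = Y" using P False by (simp_all add: f_def g_def meet join)
    moreover have "X \<in> MaxEvid (\<Inter>P)" "Y \<in> MinEvid (\<Union>P)"
      unfolding meet join using evol XY
      by (auto simp: MaxEvid_def MinEvid_def Evidb_def Evido_def)
    ultimately show ?thesis
      using XY by (auto simp: is_inf_in_def is_sup_in_def)
  qed
  have "H \<subseteq> E" using mem by (auto simp: H_def)
  moreover have "f \<in> two_subsets H \<rightarrow>\<^sub>E H" "g \<in> two_subsets H \<rightarrow>\<^sub>E H"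
    using vals by (auto simp: f_def g_def)
  ultimately have "lattice_in E (H, f, g)"
    using vals by (simp add: lattice_in_iff)
  then show thesis
    using that[of f g] IJ by (simp add: H_def f_def g_def)
qed

text \<open>Two diamonds over the same \<open>I\<close> and \<open>J\<close> must agree at
  \<open>{I, J}\<close>, where their maps take the values \<open>R\<close>, \<open>T\<close> and
  \<open>R'\<close>, \<open>T'\<close>.\<close>

lemma unique_bounds:
  assumes unique: "\<exists>!L. maximal_latt (lattice_in E) L"
    and E: "E \<subseteq> Collect evolution_ideal" and IJ: "I \<in> E" "J \<in> E" "I \<noteq> J"
    and R: "R \<in> E" "R \<in> MaxEvid (I \<inter> J)" and T: "T \<in> E" "T \<in> MinEvid (I \<union> J)"
    and R': "R' \<in> E" "R' \<in> MaxEvid (I \<inter> J)" and T': "T' \<in> E" "T' \<in> MinEvid (I \<union> J)"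
  shows "R = R'" "T = T'"
proof -
  obtain f g where fg: "lattice_in E ({R, I, J, T}, f, g)" "f {I, J} = R" "g {I, J} = T"
    using diamond_lattice[OF E R(1) IJ(1,2) T(1) IJ(3) R(2) T(2)] .
  obtain f' g' where
    fg': "lattice_in E ({R', I, J, T'}, f', g')" "f' {I, J} = R'" "g' {I, J} = T'"
    using diamond_lattice[OF E R'(1) IJ(1,2) T'(1) IJ(3) R'(2) T'(2)] .
  have "{I, J} \<in> two_subsets {R, I, J, T}" "{I, J} \<in> two_subsets {R', I, J, T'}"
    using IJ(3) by (simp_all add: two_subsets_def)
  from lattice_in_agree[OF unique fg(1) fg'(1) this] fg fg'
  show "R = R'" "T = T'" by simp_all
qed

section \<open>Existence of minimal and maximal evolution ideals\<close>

lemma evolution_ideal_zero: "evolution_ideal {0}"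
proof -
  have "mult a 0 = 0" "mult 0 a = 0" for a
    using linear_mult_left[THEN module_hom_linearI, THEN module_hom.zero]
      linear_mult_right[THEN module_hom_linearI, THEN module_hom.zero] by auto
  then have "is_ideal {0}"
    by (simp add: is_ideal_def)
  moreover have "natural_basis {0} {}"
    by (simp add: natural_basis_def independent_empty)
  ultimately show ?thesis by (auto simp: evolution_ideal_def)
qed

lemma evolution_ideal_UNIV: "evolution_algebra \<Longrightarrow> evolution_ideal UNIV"
  by (auto simp: evolution_algebra_def evolution_ideal_def is_ideal_def)

lemma dim_evolution_ideal_eqD:
  assumes "finite_dimensional_vector_space scale Basis"
    and "evolution_ideal I" "evolution_ideal J" "I \<subseteq> J" "dim J \<le> dim I"
  shows "I = J"
proof -
  interpret finite_dimensional_vector_space scale Basis by fact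
  show ?thesis
    using assms(2-) by (intro subspace_dim_equal) (auto simp: evolution_ideal_def is_ideal_def)
qed

text \<open>An evolution ideal of least dimension among those containing \<open>T\<close> is
  minimal, since nested ideals of equal dimension coincide. The whole algebra is a
  candidate.\<close>

lemma MinEvid_nonempty:
  assumes fd: "finite_dimensional_vector_space scale Basis" and "evolution_algebra"
  shows "MinEvid T \<noteq> {}"
proof -
  have "UNIV \<in> Evido T"
    using evolution_ideal_UNIV assms(2) by (simp add: Evido_def)
  from ex_has_least_nat[where P = "\<lambda>I. I \<in> Evido T" and m = dim, OF this]
  obtain I where "I \<in> Evido T" "\<And>J. J \<in> Evido T \<Longrightarrow> dim I \<le> dim J" by auto
  then have "I \<in> MinEvid T"
    using dim_evolution_ideal_eqD[OF fd] by (auto simp: MinEvid_def Evido_def)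
  then show ?thesis by blast
qed

lemma MaxEvid_nonempty:
  assumes fd: "finite_dimensional_vector_space scale Basis" and "0 \<in> T"
  shows "MaxEvid T \<noteq> {}"
proof -
  interpret finite_dimensional_vector_space scale Basis by fact
  have "{0} \<in> Evidb T"
    using evolution_ideal_zero assms(2) by (simp add: Evidb_def)
  \<comment> \<open>Dually, the greatest dimension is sought, starting from the zero ideal; the
    bound on dimensions has to be strict, hence the \<open>Suc\<close>.\<close>
  from ex_has_greatest_nat[where P = "\<lambda>I. I \<in> Evidb T" and f = dim and b = "Suc (dim UNIV)",
      OF this]
  obtain I where "I \<in> Evidb T" "\<And>J. J \<in> Evidb T \<Longrightarrow> dim J \<le> dim I"
    using dim_subset_UNIV by (auto simp: less_Suc_eq_le dimension_def)
  then have "I \<in> MaxEvid T"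
    using dim_evolution_ideal_eqD[OF fd] by (auto simp: MaxEvid_def Evidb_def)
  then show ?thesis by blast
qed

section \<open>Uniqueness of the bounds over and below a cut\<close>

lemma over_unicity_bounds:
  assumes fd: "finite_dimensional_vector_space scale Basis" and evolution_algebra
    and cut: "cut_of_over_unicity S"
    and IJ: "I \<in> Evido S" "J \<in> Evido S" "I \<noteq> J"
    and R: "evolution_ideal R" "S \<subseteq> R" "R \<in> MaxEvid (I \<inter> J)"
  shows "\<exists>!T. evolution_ideal T \<and> T \<in> MinEvid (I \<union> J)"
    and "\<exists>!R. evolution_ideal R \<and> S \<subseteq> R \<and> R \<in> MaxEvid (I \<inter> J)"
proof -
  have E: "Evido S \<subseteq> Collect evolution_ideal" by (auto simp: Evido_def)
  have min: "T \<in> Evido S" if "T \<in> MinEvid (I \<union> J)" for T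
    using that IJ by (auto simp: MinEvid_def Evido_def)
  have RE: "R \<in> Evido S" using R by (simp add: Evido_def)
  \<comment> \<open>Existence comes first: a diamond has to have a top, even when it serves to show
    that \<open>R\<close> is unique.\<close>
  obtain T where T: "T \<in> MinEvid (I \<union> J)"
    using MinEvid_nonempty[OF fd] assms(2) by blast
  note uni = unique_bounds[OF cut[unfolded cut_of_over_unicity_def lattice_over_def] E IJ]
  show "\<exists>!T. evolution_ideal T \<and> T \<in> MinEvid (I \<union> J)"
    \<comment> \<open>Both diamonds share the bottom \<open>R\<close> and only the top varies; for
      the uniqueness of \<open>R\<close> the top \<open>T\<close> is shared instead.\<close>
    using uni(2)[OF RE R(3) _ _ RE R(3)] T min E by blast
  show "\<exists>!R. evolution_ideal R \<and> S \<subseteq> R \<and> R \<in> MaxEvid (I \<inter> J)"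
    using uni(1)[OF RE R(3) min[OF T] T _ _ min[OF T] T] R unfolding Evido_def by blast
qed

lemma below_unicity_bounds:
  assumes fd: "finite_dimensional_vector_space scale Basis"
    and cut: "cut_of_below_unicity S"
    and IJ: "I \<in> Evidb S" "J \<in> Evidb S" "I \<noteq> J"
    and R: "evolution_ideal R" "R \<subseteq> S" "R \<in> MinEvid (I \<union> J)"
  shows "\<exists>!T. evolution_ideal T \<and> T \<in> MaxEvid (I \<inter> J)"
    and "\<exists>!R. evolution_ideal R \<and> R \<subseteq> S \<and> R \<in> MinEvid (I \<union> J)"
proof -
  have E: "Evidb S \<subseteq> Collect evolution_ideal" by (auto simp: Evidb_def)
  have max: "T \<in> Evidb S" if "T \<in> MaxEvid (I \<inter> J)" for T
    using that IJ by (auto simp: MaxEvid_def Evidb_def)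
  have RE: "R \<in> Evidb S" using R by (simp add: Evidb_def)
  \<comment> \<open>This makes the zero ideal a candidate below \<open>I \<inter> J\<close>, which
    yields the bottom of the diamonds; the given \<open>R\<close> is now their top.\<close>
  have "0 \<in> I \<inter> J"
    using IJ by (auto simp: Evidb_def evolution_ideal_def is_ideal_def subspace_0)
  then obtain T where T: "T \<in> MaxEvid (I \<inter> J)"
    using MaxEvid_nonempty[OF fd] by blast
  note uni = unique_bounds[OF cut[unfolded cut_of_below_unicity_def lattice_below_def] E IJ]
  show "\<exists>!T. evolution_ideal T \<and> T \<in> MaxEvid (I \<inter> J)"
    using uni(1)[OF _ _ RE R(3) _ _ RE R(3)] T max E by blast
  show "\<exists>!R. evolution_ideal R \<and> R \<subseteq> S \<and> R \<in> MinEvid (I \<union> J)"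
    using uni(2)[OF max[OF T] T RE R(3) max[OF T] T] R unfolding Evidb_def by blast
qed

end

theorem theorem33:
  fixes scale :: "'k::field \<Rightarrow> 'a::ab_group_add \<Rightarrow> 'a"
    and mult :: "'a \<Rightarrow> 'a \<Rightarrow> 'a"
    and S :: "'a set"
  assumes "nonassoc_algebra scale mult"
    and "nonassoc_algebra.evolution_algebra scale mult"
    and "\<exists>Basis. finite_dimensional_vector_space scale Basis"
  shows
    "(nonassoc_algebra.cut_of_over_unicity scale mult S \<longrightarrow>
       (\<forall>I \<in> nonassoc_algebra.Evido scale mult S. \<forall>J \<in> nonassoc_algebra.Evido scale mult S.
          I \<noteq> J \<and>
          (\<exists>R. nonassoc_algebra.evolution_ideal scale mult R \<and> S \<subseteq> R \<and>
               R \<in> nonassoc_algebra.MaxEvid scale mult (I \<inter> J)) \<longrightarrow>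
          (\<exists>!T. nonassoc_algebra.evolution_ideal scale mult T \<and>
               T \<in> nonassoc_algebra.MinEvid scale mult (I \<union> J)) \<and>
          (\<exists>!R. nonassoc_algebra.evolution_ideal scale mult R \<and> S \<subseteq> R \<and>
               R \<in> nonassoc_algebra.MaxEvid scale mult (I \<inter> J)))) \<and>
     (nonassoc_algebra.cut_of_below_unicity scale mult S \<longrightarrow>
       (\<forall>I \<in> nonassoc_algebra.Evidb scale mult S. \<forall>J \<in> nonassoc_algebra.Evidb scale mult S.
          I \<noteq> J \<and>
          (\<exists>R. nonassoc_algebra.evolution_ideal scale mult R \<and> R \<subseteq> S \<and>
               R \<in> nonassoc_algebra.MinEvid scale mult (I \<union> J)) \<longrightarrow>
          (\<exists>!T. nonassoc_algebra.evolution_ideal scale mult T \<and>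
               T \<in> nonassoc_algebra.MaxEvid scale mult (I \<inter> J)) \<and>
          (\<exists>!R. nonassoc_algebra.evolution_ideal scale mult R \<and> R \<subseteq> S \<and>
               R \<in> nonassoc_algebra.MinEvid scale mult (I \<union> J))))"
proof -
  interpret nonassoc_algebra scale mult by fact
  obtain Basis where fd: "finite_dimensional_vector_space scale Basis"
    using assms(3) by blast
  show ?thesis
    by (intro conjI impI ballI; elim conjE exE)
      (fact over_unicity_bounds[OF fd assms(2)] below_unicity_bounds[OF fd])+
qed

end
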